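(* Let $(X,d)$ be a quasi-metric space with base point $x_0$. The mapping $\delta:(X,d)\to(\mathrm{SLip}_0(X)^*,\|\cdot|^* )$ defined by $\delta(x)=\delta_x$ is injective and an isometry onto its image. Therefore, for any $x,y\in X$, $d(x,y)=\|\delta_y-\delta_x|^*$.
   Context: A quasi-metric space is a pair $(X,d)$ with $X\ne\emptyset$ and $d:X\times X\to[0,\infty)$ satisfying the triangle inequality $d(x,y)\le d(x,z)+d(z,y)$ and either ($x=y\iff d(x,y)=0$) or ($x=y\iff d(x,y)=d(y,x)=0$); both variants are allowed. $\mathrm{SLip}_0(X)$ is the cone of $f:X\to\mathbb{R}$ with $f(x_0)=0$ for which there is $L>0$ with $f(x)-f(y)\le L\,d(y,x)$ for all $x,y\in X$; $\|f|_S$ is the infimum of such $L$. $\mathrm{SLip}_0(X)^*$ is the cone of maps $\varphi:\mathrm{SLip}_0(X)\to\mathbb{R}$ that are linear (additive and commuting with multiplication by nonnegative scalars) and upper semicontinuous, equivalently such that there is $M\ge0$ with $\varphi(f)\le M\|f|_S$ for all $f$; $\|\varphi|^*=\sup_{\|f|_S\le1}\varphi(f)$. $\delta_x$ is the evaluation $\delta_x(f)=f(x)$; both $\delta_x$ and $-\delta_x$ lie in $\mathrm{SLip}_0(X)^*$. The cone $\mathrm{SLip}_0(X)^*$ carries the extended quasi-metric $d_e(\varphi,\psi)=\inf\{\|\chi|^*:\chi\in\mathrm{SLip}_0(X)^*,\ \psi=\varphi+\chi\}$ (with $\inf\emptyset=+\infty$), so that $d_e(\delta_x,\delta_y)=\|\delta_y-\delta_x|^*$.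 A bijection $\Phi$ between extended quasi-metric spaces $(X,d)$, $(Y,\rho)$ is an isometry if $\rho(\Phi(x_1),\Phi(x_2))=d(x_1,x_2)$ for all $x_1,x_2$. *)

theory Defs
  imports Complex_Main "HOL-Library.FuncSet" "HOL-Library.Extended_Real"
begin

text \<open>
  Functions on a set \<open>S\<close> (the points of \<open>X\<close>, or the cone of semi-Lipschitz functions) are
  represented by the members of \<open>extensional S\<close>, so that equality of HOL functions is equality
  on \<open>S\<close>; accordingly all pointwise operations are restricted to \<open>S\<close>.
\<close>

definition quasi_metric_on :: "'a set \<Rightarrow> ('a \<Rightarrow> 'a \<Rightarrow> real) \<Rightarrow> bool" where
  "quasi_metric_on X d \<longleftrightarrow>
     X \<noteq> {} \<and>
     (\<forall>x\<in>X. \<forall>y\<in>X. 0 \<le> d x y) \<and>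
     (\<forall>x\<in>X. \<forall>y\<in>X. \<forall>z\<in>X. d x y \<le> d x z + d z y) \<and>
     ((\<forall>x\<in>X. \<forall>y\<in>X. x = y \<longleftrightarrow> d x y = 0) \<or>
      (\<forall>x\<in>X. \<forall>y\<in>X. x = y \<longleftrightarrow> d x y = 0 \<and> d y x = 0))"

definition slip_const :: "'a set \<Rightarrow> ('a \<Rightarrow> 'a \<Rightarrow> real) \<Rightarrow> ('a \<Rightarrow> real) \<Rightarrow> real \<Rightarrow> bool" where
  "slip_const X d f L \<longleftrightarrow> 0 < L \<and> (\<forall>x\<in>X. \<forall>y\<in>X. f x - f y \<le> L * d y x)"

definition SLip0 :: "'a set \<Rightarrow> ('a \<Rightarrow> 'a \<Rightarrow> real) \<Rightarrow> 'a \<Rightarrow> ('a \<Rightarrow> real) set" where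
  "SLip0 X d x0 = {f \<in> extensional X. f x0 = 0 \<and> (\<exists>L. slip_const X d f L)}"

definition slip_norm :: "'a set \<Rightarrow> ('a \<Rightarrow> 'a \<Rightarrow> real) \<Rightarrow> ('a \<Rightarrow> real) \<Rightarrow> real" where
  "slip_norm X d f = Inf {L. slip_const X d f L}"

text \<open>
  For functionals on the cone, additivity and nonnegative homogeneity together with the bound
  \<open>\<phi> f \<le> M * slip_norm X d f\<close> say that \<open>\<phi>\<close> is linear and upper semicontinuous. There is no lower
  bound, so the dual is a cone which need not be closed under negation.
\<close>

definition SLip0_dual ::
  "'a set \<Rightarrow> ('a \<Rightarrow> 'a \<Rightarrow> real) \<Rightarrow> 'a \<Rightarrow> (('a \<Rightarrow> real) \<Rightarrow> real) set" where
  "SLip0_dual X d x0 =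
     {\<phi> \<in> extensional (SLip0 X d x0).
        (\<forall>f\<in>SLip0 X d x0. \<forall>g\<in>SLip0 X d x0. \<phi> (\<lambda>x\<in>X. f x + g x) = \<phi> f + \<phi> g) \<and>
        (\<forall>c\<ge>0. \<forall>f\<in>SLip0 X d x0. \<phi> (\<lambda>x\<in>X. c * f x) = c * \<phi> f) \<and>
        (\<exists>M\<ge>0. \<forall>f\<in>SLip0 X d x0. \<phi> f \<le> M * slip_norm X d f)}"

text \<open>
  The supremum is one of reals; on \<open>SLip0_dual X d x0\<close> it is taken over a nonempty set bounded
  above.
\<close>

definition dual_norm ::
  "'a set \<Rightarrow> ('a \<Rightarrow> 'a \<Rightarrow> real) \<Rightarrow> 'a \<Rightarrow> (('a \<Rightarrow> real) \<Rightarrow> real) \<Rightarrow> real" where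
  "dual_norm X d x0 \<phi> = (SUP f\<in>{f \<in> SLip0 X d x0. slip_norm X d f \<le> 1}. \<phi> f)"

definition dual_dist ::
  "'a set \<Rightarrow> ('a \<Rightarrow> 'a \<Rightarrow> real) \<Rightarrow> 'a \<Rightarrow>
     (('a \<Rightarrow> real) \<Rightarrow> real) \<Rightarrow> (('a \<Rightarrow> real) \<Rightarrow> real) \<Rightarrow> ereal" where
  "dual_dist X d x0 \<phi> \<psi> =
     Inf {ereal (dual_norm X d x0 \<chi>) | \<chi>.
            \<chi> \<in> SLip0_dual X d x0 \<and> \<psi> = (\<lambda>f\<in>SLip0 X d x0. \<phi> f + \<chi> f)}"

definition point_eval ::
  "'a set \<Rightarrow> ('a \<Rightarrow> 'a \<Rightarrow> real) \<Rightarrow> 'a \<Rightarrow> 'a \<Rightarrow> ('a \<Rightarrow> real) \<Rightarrow> real" where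
  "point_eval X d x0 x = (\<lambda>f\<in>SLip0 X d x0. f x)"

definition functional_diff ::
  "'a set \<Rightarrow> ('a \<Rightarrow> 'a \<Rightarrow> real) \<Rightarrow> 'a \<Rightarrow>
     (('a \<Rightarrow> real) \<Rightarrow> real) \<Rightarrow> (('a \<Rightarrow> real) \<Rightarrow> real) \<Rightarrow> ('a \<Rightarrow> real) \<Rightarrow> real" where
  "functional_diff X d x0 \<phi> \<psi> = (\<lambda>f\<in>SLip0 X d x0. \<phi> f - \<psi> f)"

definition isometry_between ::
  "'a set \<Rightarrow> ('a \<Rightarrow> 'a \<Rightarrow> ereal) \<Rightarrow> 'b set \<Rightarrow> ('b \<Rightarrow> 'b \<Rightarrow> ereal) \<Rightarrow> ('a \<Rightarrow> 'b) \<Rightarrow> bool" where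
  "isometry_between X d Y \<rho> \<Phi> \<longleftrightarrow>
     bij_betw \<Phi> X Y \<and> (\<forall>x1\<in>X. \<forall>x2\<in>X. \<rho> (\<Phi> x1) (\<Phi> x2) = d x1 x2)"

end

theory Submission
  imports Defs
begin

text \<open>
  The increment \<open>f y - f x\<close> of a semi-Lipschitz function \<open>f\<close> never exceeds \<open>slip_norm X d f * d x y\<close>,
  because the semi-Lipschitz inequality passes to the infimum of the admissible constants
  (lemma \<open>increment_le_slip_norm\<close>). Hence \<open>f \<mapsto> f y - f x\<close> lies in the dual cone with norm at most
  \<open>d x y\<close>. The bound is attained by the distance from \<open>x\<close>, shifted to vanish at the base point: it
  has semi-Lipschitz constant \<open>1\<close> by the triangle inequality, and its increment from \<open>x\<close> to \<open>y\<close> is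
  \<open>d x y\<close> since \<open>d x x = 0\<close>. The order of the arguments matters, because \<open>d\<close> is not symmetric: it
  must be \<open>d x z\<close> as a function of \<open>z\<close>, not \<open>d z x\<close>. So the norm of the increment functional is
  exactly \<open>d x y\<close> (lemma \<open>dual_norm_increment\<close>).

  The rest is formal. Evaluation at \<open>x\<close> is the increment from the base point to \<open>x\<close>, so it lies in
  the dual cone. Functionals take real values, so the evaluation at \<open>y\<close> is the sum of the
  evaluation at \<open>x\<close> and exactly one member of the dual, the increment functional, and the infimum
  defining \<open>dual_dist\<close> ranges over a single number. Finally, equal evaluations at \<open>x\<close> and \<open>y\<close> make the
  increments in both directions vanish, so \<open>d x y = d y x = 0\<close>, which separates points under either
  variant of the quasi-metric axioms.
\<close>

lemma quasi_metric_self: "quasi_metric_on X d \<Longrightarrow> x \<in> X \<Longrightarrow> d x x = 0"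
  unfolding quasi_metric_on_def by blast

lemma quasi_metric_nonneg: "quasi_metric_on X d \<Longrightarrow> x \<in> X \<Longrightarrow> y \<in> X \<Longrightarrow> 0 \<le> d x y"
  by (simp add: quasi_metric_on_def)

lemma quasi_metric_triangle:
  "quasi_metric_on X d \<Longrightarrow> x \<in> X \<Longrightarrow> y \<in> X \<Longrightarrow> z \<in> X \<Longrightarrow> d x y \<le> d x z + d z y"
  by (simp add: quasi_metric_on_def)

lemma quasi_metric_eqI:
  "quasi_metric_on X d \<Longrightarrow> x \<in> X \<Longrightarrow> y \<in> X \<Longrightarrow> d x y = 0 \<Longrightarrow> d y x = 0 \<Longrightarrow> x = y"
  unfolding quasi_metric_on_def by blast

lemma SLip0_base: "f \<in> SLip0 X d x0 \<Longrightarrow> f x0 = 0"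
  by (simp add: SLip0_def)

lemma slip_norm_le: "slip_const X d f L \<Longrightarrow> slip_norm X d f \<le> L"
  unfolding slip_norm_def
  by (rule cInf_lower) (auto intro!: bdd_belowI[of _ 0] simp: slip_const_def)

lemma increment_le_slip_norm:
  assumes "quasi_metric_on X d" "f \<in> SLip0 X d x0" "x \<in> X" "y \<in> X"
  shows "f y - f x \<le> slip_norm X d f * d x y"
proof (cases "d x y = 0")
  case True
  then show ?thesis
    using assms(2-) by (force simp: SLip0_def slip_const_def)
next
  case False
  then have pos: "0 < d x y"
    using quasi_metric_nonneg[OF assms(1,3,4)] by simp
  have "(f y - f x) / d x y \<le> slip_norm X d f"
    unfolding slip_norm_def
  proof (rule cInf_greatest)
    show "{L. slip_const X d f L} \<noteq> {}"
      using assms(2) by (auto simp: SLip0_def)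
    show "(f y - f x) / d x y \<le> L" if "L \<in> {L. slip_const X d f L}" for L
      using that assms(3,4) pos by (auto simp: slip_const_def pos_divide_le_eq)
  qed
  then show ?thesis
    using pos by (simp add: pos_divide_le_eq)
qed

text \<open>
  Closure of the cone under its operations is what lets evaluations, which are restricted to the
  cone, be computed on sums and multiples.
\<close>

lemma SLip0_add:
  assumes "x0 \<in> X" "f \<in> SLip0 X d x0" "g \<in> SLip0 X d x0"
  shows "(\<lambda>x\<in>X. f x + g x) \<in> SLip0 X d x0"
proof -
  obtain L M where L: "slip_const X d f L" and M: "slip_const X d g M"
    using assms by (auto simp: SLip0_def)
  have "slip_const X d (\<lambda>x\<in>X. f x + g x) (L + M)"
    unfolding slip_const_def
  proof (intro conjI ballI)
    show "0 < L + M"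
      using L M by (simp add: slip_const_def)
    fix x y assume xy: "x \<in> X" "y \<in> X"
    then have "f x - f y \<le> L * d y x" "g x - g y \<le> M * d y x"
      using L M by (simp_all add: slip_const_def)
    then show "(\<lambda>x\<in>X. f x + g x) x - (\<lambda>x\<in>X. f x + g x) y \<le> (L + M) * d y x"
      using xy by (simp add: distrib_right)
  qed
  then show ?thesis
    using assms by (auto simp: SLip0_def)
qed

lemma SLip0_scale:
  assumes "quasi_metric_on X d" "x0 \<in> X" "0 \<le> c" "f \<in> SLip0 X d x0"
  shows "(\<lambda>x\<in>X. c * f x) \<in> SLip0 X d x0"
proof -
  obtain L where L: "slip_const X d f L"
    using assms by (auto simp: SLip0_def)
  \<comment> \<open>The summand 1 keeps the constant strictly positive when c = 0.\<close>
  have "slip_const X d (\<lambda>x\<in>X. c * f x) (c * L + 1)"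
    unfolding slip_const_def
  proof (intro conjI ballI)
    show "0 < c * L + 1"
      using L \<open>0 \<le> c\<close> by (simp add: slip_const_def add_nonneg_pos)
    fix x y assume xy: "x \<in> X" "y \<in> X"
    have "c * (f x - f y) \<le> c * (L * d y x)"
      using L xy \<open>0 \<le> c\<close> by (intro mult_left_mono) (auto simp: slip_const_def)
    then show "(\<lambda>x\<in>X. c * f x) x - (\<lambda>x\<in>X. c * f x) y \<le> (c * L + 1) * d y x"
      using xy quasi_metric_nonneg[OF assms(1) xy(2,1)] by (simp add: algebra_simps)
  qed
  then show ?thesis
    using assms by (auto simp: SLip0_def)
qed

text \<open>
  The shifted distance from \<open>x\<close> is the function on which the increment functionals starting at \<open>x\<close>
  attain their norms.
\<close>

lemma distance_from_slip_const:
  assumes "quasi_metric_on X d" "x \<in> X"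
  shows "slip_const X d (\<lambda>z\<in>X. d x z - c) 1"
  unfolding slip_const_def
proof (intro conjI ballI)
  fix u v assume "u \<in> X" "v \<in> X"
  then show "(\<lambda>z\<in>X. d x z - c) u - (\<lambda>z\<in>X. d x z - c) v \<le> 1 * d v u"
    using quasi_metric_triangle[OF assms \<open>u \<in> X\<close> \<open>v \<in> X\<close>] by simp
qed simp

lemma functional_diff_point_eval:
  "functional_diff X d x0 (point_eval X d x0 y) (point_eval X d x0 x)
     = (\<lambda>f\<in>SLip0 X d x0. f y - f x)"
  by (auto simp: functional_diff_def point_eval_def)

lemma increment_in_dual:
  assumes "quasi_metric_on X d" "x0 \<in> X" "x \<in> X" "y \<in> X"
  shows "(\<lambda>f\<in>SLip0 X d x0. f y - f x) \<in> SLip0_dual X d x0"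
  unfolding SLip0_dual_def
proof (intro CollectI conjI ballI allI impI)
  let ?\<phi> = "\<lambda>f\<in>SLip0 X d x0. f y - f x"
  show "?\<phi> \<in> extensional (SLip0 X d x0)"
    by simp
  show "?\<phi> (\<lambda>z\<in>X. f z + g z) = ?\<phi> f + ?\<phi> g"
    if "f \<in> SLip0 X d x0" "g \<in> SLip0 X d x0" for f g
    using SLip0_add[OF assms(2) that] that assms(3,4) by simp
  show "?\<phi> (\<lambda>z\<in>X. c * f z) = c * ?\<phi> f" if "0 \<le> c" "f \<in> SLip0 X d x0" for c f
    using SLip0_scale[OF assms(1,2) that] that assms(3,4) by (simp add: right_diff_distrib)
  show "\<exists>M\<ge>0. \<forall>f\<in>SLip0 X d x0. ?\<phi> f \<le> M * slip_norm X d f"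
  proof (intro exI conjI ballI)
    show "0 \<le> d x y"
      using assms by (simp add: quasi_metric_nonneg)
    show "?\<phi> f \<le> d x y * slip_norm X d f" if "f \<in> SLip0 X d x0" for f
      using increment_le_slip_norm[OF assms(1) that assms(3,4)] that
      by (simp add: mult.commute)
  qed
qed

lemma dual_norm_increment:
  assumes "quasi_metric_on X d" "x0 \<in> X" "x \<in> X" "y \<in> X"
  shows "dual_norm X d x0 (\<lambda>f\<in>SLip0 X d x0. f y - f x) = d x y"
  unfolding dual_norm_def
proof (rule cSup_eq_maximum)
  let ?\<phi> = "\<lambda>f\<in>SLip0 X d x0. f y - f x"
  let ?B = "{f \<in> SLip0 X d x0. slip_norm X d f \<le> 1}"
  let ?g = "\<lambda>z\<in>X. d x z - d x x0"
  have slip: "slip_const X d ?g 1"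
    by (rule distance_from_slip_const[OF assms(1,3)])
  then have g: "?g \<in> SLip0 X d x0"
    using assms(2) by (auto simp: SLip0_def)
  then have B: "?g \<in> ?B"
    using slip_norm_le[OF slip] by simp
  have "?\<phi> ?g = d x y"
    using g assms by (simp add: quasi_metric_self)
  then show "d x y \<in> ?\<phi> ` ?B"
    by (rule image_eqI[OF sym B])
  show "r \<le> d x y" if r: "r \<in> ?\<phi> ` ?B" for r
  proof -
    obtain f where f: "f \<in> SLip0 X d x0" "slip_norm X d f \<le> 1" "r = f y - f x"
      using r by auto
    have "r \<le> slip_norm X d f * d x y"
      using increment_le_slip_norm[OF assms(1) f(1) assms(3,4)] f(3) by simp
    also have "\<dots> \<le> 1 * d x y"
      using f(2) quasi_metric_nonneg[OF assms(1,3,4)] by (rule mult_right_mono)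
    finally show ?thesis by simp
  qed
qed

lemma point_eval_in_dual:
  assumes "quasi_metric_on X d" "x0 \<in> X" "x \<in> X"
  shows "point_eval X d x0 x \<in> SLip0_dual X d x0"
proof -
  have "point_eval X d x0 x = (\<lambda>f\<in>SLip0 X d x0. f x - f x0)"
    unfolding point_eval_def by (rule restrict_ext) (simp add: SLip0_base)
  then show ?thesis
    using increment_in_dual[OF assms(1,2,2,3)] by simp
qed

text \<open>
  The infimum is over the single functional \<open>f \<mapsto> f y - f x\<close>: members of the dual are extensional,
  so their values on the cone determine them.
\<close>

lemma dual_dist_point_eval:
  assumes "quasi_metric_on X d" "x0 \<in> X" "x \<in> X" "y \<in> X"
  shows "dual_dist X d x0 (point_eval X d x0 x) (point_eval X d x0 y) = ereal (d x y)"
proof -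
  let ?\<phi> = "\<lambda>f\<in>SLip0 X d x0. f y - f x"
  have "\<chi> \<in> SLip0_dual X d x0 \<and>
        point_eval X d x0 y = (\<lambda>f\<in>SLip0 X d x0. point_eval X d x0 x f + \<chi> f)
        \<longleftrightarrow> \<chi> = ?\<phi>" for \<chi>
  proof
    assume \<chi>: "\<chi> \<in> SLip0_dual X d x0 \<and>
        point_eval X d x0 y = (\<lambda>f\<in>SLip0 X d x0. point_eval X d x0 x f + \<chi> f)"
    show "\<chi> = ?\<phi>"
    proof (rule extensionalityI)
      show "\<chi> \<in> extensional (SLip0 X d x0)"
        using \<chi> by (simp add: SLip0_dual_def)
      show "\<chi> f = ?\<phi> f" if "f \<in> SLip0 X d x0" for f
        using fun_cong[OF conjunct2[OF \<chi>], of f] that by (simp add: point_eval_def)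
    qed simp
  next
    assume "\<chi> = ?\<phi>"
    then show "\<chi> \<in> SLip0_dual X d x0 \<and>
        point_eval X d x0 y = (\<lambda>f\<in>SLip0 X d x0. point_eval X d x0 x f + \<chi> f)"
      using increment_in_dual[OF assms] by (auto simp: point_eval_def)
  qed
  then show ?thesis
    unfolding dual_dist_def by (simp add: dual_norm_increment[OF assms])
qed

lemma inj_on_point_eval:
  assumes "quasi_metric_on X d" "x0 \<in> X"
  shows "inj_on (point_eval X d x0) X"
proof (rule inj_onI)
  fix x y assume xy: "x \<in> X" "y \<in> X" and eq: "point_eval X d x0 x = point_eval X d x0 y"
  have zero: "d u v = 0"
    if "u \<in> X" "v \<in> X" "point_eval X d x0 u = point_eval X d x0 v" for u v
  proof -
    have "ereal (d u v) = ereal (d u u)"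
      using dual_dist_point_eval[OF assms that(1,2)] dual_dist_point_eval[OF assms that(1,1)]
        that(3) by simp
    then show ?thesis
      using quasi_metric_self[OF assms(1) that(1)] by simp
  qed
  show "x = y"
    using quasi_metric_eqI[OF assms(1) xy zero[OF xy eq] zero[OF xy(2,1) eq[symmetric]]] .
qed

theorem proposition3p3:
  fixes X :: "'a set" and d :: "'a \<Rightarrow> 'a \<Rightarrow> real" and x0 :: 'a
  assumes "quasi_metric_on X d"
    and "x0 \<in> X"
  shows "point_eval X d x0 \<in> X \<rightarrow> SLip0_dual X d x0
    \<and> inj_on (point_eval X d x0) X
    \<and> isometry_between X (\<lambda>x y. ereal (d x y))
        (point_eval X d x0 ` X) (dual_dist X d x0) (point_eval X d x0)
    \<and> (\<forall>x\<in>X. \<forall>y\<in>X.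
          functional_diff X d x0 (point_eval X d x0 y) (point_eval X d x0 x) \<in> SLip0_dual X d x0
        \<and> d x y = dual_norm X d x0
            (functional_diff X d x0 (point_eval X d x0 y) (point_eval X d x0 x)))"
  unfolding functional_diff_point_eval isometry_between_def
proof (intro conjI ballI funcsetI)
  show "bij_betw (point_eval X d x0) X (point_eval X d x0 ` X)"
    by (rule inj_on_imp_bij_betw) (rule inj_on_point_eval[OF assms])
qed (simp_all add: point_eval_in_dual[OF assms] inj_on_point_eval[OF assms]
    dual_dist_point_eval[OF assms] increment_in_dual[OF assms] dual_norm_increment[OF assms])

end
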